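(* Let $\alpha$ be an isometric automorphism of $\ell_\infty=\ell_\infty(\mathbb{Z})$, and let $\sigma$ be the associated permutation of $\mathbb{Z}$. If there is a finite bound on the cardinality of the orbits of $\sigma$ then $\mathrm{hc}(\alpha)=0$; if there is no such finite bound then $\mathrm{hc}(\alpha)=\infty$.
   Context: $\ell_\infty$ is the complex Banach space of bounded functions on $\mathbb{Z}$ with the supremum norm. For every isometric (surjective linear) automorphism $\alpha$ of $\ell_\infty$ there are a function $\lambda:\mathbb{Z}\to\mathbb{T}$ (the unit circle) and a permutation $\sigma$ of $\mathbb{Z}$ such that $\alpha(x)(s)=\lambda(s)x(\sigma(s))$ for all $x\in\ell_\infty$ and $s\in\mathbb{Z}$; $\sigma$ is the associated permutation. CA entropy: For a bounded linear map $\gamma:X\to Y$ of (complex) Banach spaces, a finite set $\Omega\subseteq X$ and $\delta>0$, let $\mathrm{CA}(\gamma,\Omega,\delta)$ be the collection of triples $(\phi,\psi,d)$ where $d$ is a positive integer and $\phi:X\to\ell_\infty^d$, $\psi:\ell_\infty^d\to Y$ are contractive (norm $\le1$) linear maps with $\|\psi\circ\phi(x)-\gamma(x)\|<\delta$ for all $x\in\Omega$. A CA embedding of $X$ is an isometric linear map $\iota$ from $X$ into a Banach space $Y$ such that $\mathrm{CA}(\iota,\Omega,\delta)\neq\emptyset$ for all finite $\Omega\subseteq X$ and $\delta>0$; every Banach space has one (e.g. the evaluation map $X\to C(B_1(X^* ))$, where $B_1(X^* )$ is the weak$^*$ compact unit ball of the dual). Set $\mathrm{rc}(\Omega,\delta)=\inf\{d:(\phi,\psi,d)\in\mathrm{CA}(\iota,\Omega,\delta)\}$,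 which does not depend on the CA embedding $\iota$. For an isometric (surjective linear) automorphism $\alpha$ of $X$ put $\mathrm{hc}(\alpha,\Omega,\delta)=\limsup_{n\to\infty}\frac1n\log\mathrm{rc}(\Omega\cup\alpha\Omega\cup\cdots\cup\alpha^{n-1}\Omega,\delta)$, $\mathrm{hc}(\alpha,\Omega)=\sup_{\delta>0}\mathrm{hc}(\alpha,\Omega,\delta)$, and $\mathrm{hc}(\alpha)=\sup_\Omega\mathrm{hc}(\alpha,\Omega)$ over finite $\Omega\subseteq X$. *)

theory Defs
  imports "HOL-Analysis.Analysis"
begin

section \<open>Complex Banach spaces\<close>

class scaleC =
  fixes scaleC :: "complex \<Rightarrow> 'a \<Rightarrow> 'a" (infixr \<open>*\<^sub>C\<close> 75)

class complex_banach = banach + scaleC +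
  assumes scaleC_add_right: "c *\<^sub>C (x + y) = c *\<^sub>C x + c *\<^sub>C y"
    and scaleC_add_left: "(b + c) *\<^sub>C x = b *\<^sub>C x + c *\<^sub>C x"
    and scaleC_scaleC: "b *\<^sub>C (c *\<^sub>C x) = (b * c) *\<^sub>C x"
    and scaleC_of_real: "complex_of_real r *\<^sub>C x = r *\<^sub>R x"
    and norm_scaleC: "norm (c *\<^sub>C x) = cmod c * norm x"

instantiation complex :: complex_banach
begin

definition scaleC_complex :: "complex \<Rightarrow> complex \<Rightarrow> complex"
  where "scaleC_complex c z = c * z"

instance
  by standard
    (simp_all add: scaleC_complex_def algebra_simps scaleR_conv_of_real norm_mult)

end

lemma continuous_on_scaleC:
  fixes f :: "'a::topological_space \<Rightarrow> 'b::complex_banach"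
  assumes "continuous_on S f"
  shows "continuous_on S (\<lambda>x. c *\<^sub>C f x)"
proof -
  have "bounded_linear (\<lambda>x::'b. c *\<^sub>C x)"
  proof (rule bounded_linear_intro[where K = "cmod c"])
    fix r :: real and x :: 'b
    show "c *\<^sub>C (r *\<^sub>R x) = r *\<^sub>R (c *\<^sub>C x)"
      by (simp add: scaleC_of_real[symmetric] scaleC_scaleC mult.commute)
  qed (simp_all add: scaleC_add_right norm_scaleC mult.commute)
  from bounded_linear.continuous_on[OF this assms] show ?thesis .
qed

text \<open>
  The spaces of bounded continuous functions become complex Banach spaces under the pointwise
  operations and the supremum norm.  As \<^typ>\<open>int\<close> and \<^typ>\<open>nat\<close> are discrete, every
  bounded function on them is continuous, so that \<open>int \<Rightarrow>\<^sub>C complex\<close> is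
  the space of all bounded complex functions on the integers.
\<close>

text \<open>The library states completeness for metric domains only, and \<^typ>\<open>int\<close> and
  \<^typ>\<open>nat\<close> are not instances of that class.\<close>

instance bcontfun :: (topological_space, complete_space) complete_space
proof
  fix f :: "nat \<Rightarrow> ('a, 'b) bcontfun"
  assume "Cauchy f"
  then obtain g where "uniform_limit UNIV f g sequentially"
    using uniformly_convergent_eq_cauchy[of "\<lambda>_. True" f]
    unfolding Cauchy_def uniform_limit_sequentially_iff
    by (metis dist_fun_lt_imp_dist_val_lt)
  from uniform_limit_bcontfunE[OF this sequentially_bot]
  obtain l' where "g = apply_bcontfun l'" "f \<longlonglongrightarrow> l'" by metis
  then show "convergent f"
    by (intro convergentI)
qed

instance bcontfun :: (topological_space, banach) banach ..

instantiation bcontfun :: (topological_space, complex_banach) complex_banach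
begin

definition scaleC_bcontfun :: "complex \<Rightarrow> ('a \<Rightarrow>\<^sub>C 'b) \<Rightarrow> 'a \<Rightarrow>\<^sub>C 'b"
  where "scaleC_bcontfun c f = Bcontfun (\<lambda>s. c *\<^sub>C apply_bcontfun f s)"

lemma apply_bcontfun_scaleC:
  fixes f :: "'a \<Rightarrow>\<^sub>C 'b"
  shows "apply_bcontfun (c *\<^sub>C f) s = c *\<^sub>C apply_bcontfun f s"
proof -
  have "(\<lambda>s. c *\<^sub>C apply_bcontfun f s) \<in> bcontfun"
    by (rule bcontfun_normI[where b = "cmod c * norm f"])
      (auto intro!: continuous_on_scaleC mult_left_mono norm_bounded simp: norm_scaleC)
  then show ?thesis
    by (simp add: scaleC_bcontfun_def Bcontfun_inverse)
qed

instance
proof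
  fix b c :: complex and r :: real and f g :: "'a \<Rightarrow>\<^sub>C 'b"
  show "c *\<^sub>C (f + g) = c *\<^sub>C f + c *\<^sub>C g"
    by (rule bcontfun_eqI) (simp add: apply_bcontfun_scaleC scaleC_add_right)
  show "(b + c) *\<^sub>C f = b *\<^sub>C f + c *\<^sub>C f"
    by (rule bcontfun_eqI) (simp add: apply_bcontfun_scaleC scaleC_add_left)
  show scale: "b *\<^sub>C c *\<^sub>C f = (b * c) *\<^sub>C f" for b c and f :: "'a \<Rightarrow>\<^sub>C 'b"
    by (rule bcontfun_eqI) (simp add: apply_bcontfun_scaleC scaleC_scaleC)
  show real: "complex_of_real r *\<^sub>C f = r *\<^sub>R f" for r and f :: "'a \<Rightarrow>\<^sub>C 'b"
    by (rule bcontfun_eqI) (simp add: apply_bcontfun_scaleC scaleC_of_real)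
  have le: "norm (c *\<^sub>C f) \<le> cmod c * norm f" for c and f :: "'a \<Rightarrow>\<^sub>C 'b"
    by (rule norm_bound)
      (auto simp: apply_bcontfun_scaleC norm_scaleC intro!: mult_left_mono norm_bounded)
  show "norm (c *\<^sub>C f) = cmod c * norm f"
  proof (cases "c = 0")
    case True
    then show ?thesis using real[of 0 f] by simp
  next
    case False
    have "f = inverse c *\<^sub>C c *\<^sub>C f"
      using False real[of 1 f] by (simp add: scale)
    then have "norm f \<le> inverse (cmod c) * norm (c *\<^sub>C f)"
      using le[of "inverse c" "c *\<^sub>C f"] by (simp add: norm_inverse)
    then have "cmod c * norm f \<le> norm (c *\<^sub>C f)"
      using False by (simp add: field_simps)
    with le[of c f] show ?thesis by simp
  qed
qed

end

definition clinear_on :: "'a::complex_banach set \<Rightarrow> ('a \<Rightarrow> 'b::complex_banach) \<Rightarrow> bool"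
  where "clinear_on S f \<longleftrightarrow>
    (\<forall>x\<in>S. \<forall>y\<in>S. f (x + y) = f x + f y) \<and> (\<forall>c. \<forall>x\<in>S. f (c *\<^sub>C x) = c *\<^sub>C f x)"

definition contractive_on :: "'a::complex_banach set \<Rightarrow> ('a \<Rightarrow> 'b::complex_banach) \<Rightarrow> bool"
  where "contractive_on S f \<longleftrightarrow> (\<forall>x\<in>S. norm (f x) \<le> norm x)"

definition isometric_automorphism :: "('a::complex_banach \<Rightarrow> 'a) \<Rightarrow> bool"
  where "isometric_automorphism \<alpha> \<longleftrightarrow>
    clinear_on UNIV \<alpha> \<and> surj \<alpha> \<and> (\<forall>x. norm (\<alpha> x) = norm x)"

section \<open>CA entropy\<close>

text \<open>
  Since the dimension \<open>d\<close> has to vary inside a formula, the space of \<open>d\<close>-tuples with the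
  maximum norm is represented by the subspace of all bounded sequences supported in
  \<open>{..<d}\<close>; the supremum norm restricts to the maximum norm on it.
\<close>

definition linf :: "nat \<Rightarrow> (nat \<Rightarrow>\<^sub>C complex) set"
  where "linf d = {v. \<forall>i\<ge>d. apply_bcontfun v i = 0}"

text \<open>The values of \<open>\<psi>\<close> outside \<open>linf d\<close> are irrelevant.\<close>

definition CA :: "('a::complex_banach \<Rightarrow> 'b::complex_banach) \<Rightarrow> 'a set \<Rightarrow> real \<Rightarrow>
    (('a \<Rightarrow> nat \<Rightarrow>\<^sub>C complex) \<times> ((nat \<Rightarrow>\<^sub>C complex) \<Rightarrow> 'b) \<times> nat) set"
  where "CA \<gamma> \<Omega> \<delta> = {(\<phi>, \<psi>, d). 0 < d \<and>
    range \<phi> \<subseteq> linf d \<and> clinear_on UNIV \<phi> \<and> contractive_on UNIV \<phi> \<and>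
    clinear_on (linf d) \<psi> \<and> contractive_on (linf d) \<psi> \<and>
    (\<forall>x\<in>\<Omega>. norm ((\<psi> \<circ> \<phi>) x - \<gamma> x) < \<delta>)}"

definition CA_embedding :: "('a::complex_banach \<Rightarrow> 'b::complex_banach) \<Rightarrow> bool"
  where "CA_embedding \<iota> \<longleftrightarrow> clinear_on UNIV \<iota> \<and> (\<forall>x. norm (\<iota> x) = norm x) \<and>
    (\<forall>\<Omega> \<delta>. finite \<Omega> \<longrightarrow> \<delta> > 0 \<longrightarrow> CA \<iota> \<Omega> \<delta> \<noteq> {})"

text \<open>
  CA embeddings of the space under consideration exist: already the identity map is one.
\<close>

lemma CA_embedding_id: "CA_embedding (\<lambda>x :: int \<Rightarrow>\<^sub>C complex. x)"
proof -
  have bc: "apply_bcontfun (Bcontfun f) = f" if "\<And>s. cmod (f s) \<le> B"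
    for f :: "'i::discrete_topology \<Rightarrow> complex" and B :: real
    by (rule Bcontfun_inverse, rule bcontfun_normI[OF _ that]) simp
  have "CA (\<lambda>x. x) \<Omega> \<delta> \<noteq> {}" if \<Omega>: "finite \<Omega>" and \<delta>: "\<delta> > 0"
    for \<Omega> :: "(int \<Rightarrow>\<^sub>C complex) set" and \<delta> :: real
  proof -
    define \<epsilon> where "\<epsilon> = \<delta> / 4"
    have \<epsilon>: "\<epsilon> > 0" using \<delta> by (simp add: \<epsilon>_def)
    define cell where "cell = (\<lambda>z. (\<lfloor>Re z / \<epsilon>\<rfloor>, \<lfloor>Im z / \<epsilon>\<rfloor>))"
    have cell: "cmod (z - w) \<le> 2 * \<epsilon>" if eq: "cell z = cell w" for z w
    proof -
      have aux: "\<bar>a - b\<bar> \<le> \<epsilon>" if "\<lfloor>a / \<epsilon>\<rfloor> = \<lfloor>b / \<epsilon>\<rfloor>" for a b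
      proof -
        have "\<bar>a / \<epsilon> - b / \<epsilon>\<bar> \<le> 1" using that by linarith
        then have "\<bar>(a - b) / \<epsilon>\<bar> \<le> 1" by (simp add: diff_divide_distrib)
        then show ?thesis using \<epsilon> by (simp add: abs_divide)
      qed
      have "cmod (z - w) \<le> \<bar>Re z - Re w\<bar> + \<bar>Im z - Im w\<bar>"
        using cmod_le[of "z - w"] by simp
      then show ?thesis
        using aux[of "Re z" "Re w"] aux[of "Im z" "Im w"] eq by (simp add: cell_def)
    qed
    define g where "g = (\<lambda>s. restrict (\<lambda>x. cell (apply_bcontfun x s)) \<Omega>)"
    define I where "I = (\<lambda>x::int \<Rightarrow>\<^sub>C complex. {\<lfloor>- (norm x / \<epsilon>)\<rfloor>..\<lfloor>norm x / \<epsilon>\<rfloor>})"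
    have cell_I: "cell (apply_bcontfun x s) \<in> I x \<times> I x" for x s
    proof -
      have "\<lfloor>a / \<epsilon>\<rfloor> \<in> I x" if "\<bar>a\<bar> \<le> norm x" for a
      proof -
        have "- (norm x / \<epsilon>) \<le> a / \<epsilon>" "a / \<epsilon> \<le> norm x / \<epsilon>"
          using that \<epsilon> by (auto simp: divide_simps)
        then show ?thesis by (simp add: I_def floor_mono)
      qed
      moreover have "\<bar>Re (apply_bcontfun x s)\<bar> \<le> norm x" "\<bar>Im (apply_bcontfun x s)\<bar> \<le> norm x"
        using abs_Re_le_cmod abs_Im_le_cmod norm_bounded[of x s] order_trans by blast+
      ultimately show ?thesis by (simp add: cell_def)
    qed
    have "range g \<subseteq> (\<Pi>\<^sub>E x\<in>\<Omega>. I x \<times> I x)"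
      using cell_I by (auto simp: g_def)
    moreover have "finite (\<Pi>\<^sub>E x\<in>\<Omega>. I x \<times> I x)"
      using \<Omega> by (intro finite_PiE) (simp_all add: I_def)
    ultimately have "finite (range g)" by (rule finite_subset)
    then obtain d and f :: "_ \<Rightarrow> nat" where f: "f ` range g = {i. i < d}" "inj_on f (range g)"
      using finite_imp_inj_to_nat_seg by metis
    define idx where "idx = (\<lambda>s. f (g s))"
    define rep where "rep = inv idx"
    have idx: "idx s < d" for s using f by (auto simp: idx_def)
    then have d: "0 < d" using gr_zeroI by fastforce
    have "idx (rep (idx s)) = idx s" for s
      by (simp add: rep_def f_inv_into_f)
    then have "g (rep (idx s)) = g s" for s
      using f(2) by (metis idx_def inj_onD rangeI)
    then have "cell (apply_bcontfun x (rep (idx s))) = cell (apply_bcontfun x s)"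
      if "x \<in> \<Omega>" for x s
      using that by (metis g_def restrict_apply')
    then have close: "cmod (apply_bcontfun x (rep (idx s)) - apply_bcontfun x s) \<le> 2 * \<epsilon>"
      if "x \<in> \<Omega>" for x s
      using that cell by blast
    define \<phi> :: "(int \<Rightarrow>\<^sub>C complex) \<Rightarrow> nat \<Rightarrow>\<^sub>C complex"
      where "\<phi> = (\<lambda>x. Bcontfun (\<lambda>i. if i < d then apply_bcontfun x (rep i) else 0))"
    define \<psi> :: "(nat \<Rightarrow>\<^sub>C complex) \<Rightarrow> int \<Rightarrow>\<^sub>C complex"
      where "\<psi> = (\<lambda>v. Bcontfun (\<lambda>s. apply_bcontfun v (idx s)))"
    have \<phi>: "apply_bcontfun (\<phi> x) = (\<lambda>i. if i < d then apply_bcontfun x (rep i) else 0)" for x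
      unfolding \<phi>_def by (rule bc[of _ "norm x"]) (simp add: norm_bounded)
    have \<psi>: "apply_bcontfun (\<psi> v) = (\<lambda>s. apply_bcontfun v (idx s))" for v
      unfolding \<psi>_def by (rule bc[of _ "norm v"]) (simp add: norm_bounded)
    have "norm (\<psi> (\<phi> x) - x) < \<delta>" if "x \<in> \<Omega>" for x
    proof -
      have "norm (\<psi> (\<phi> x) - x) \<le> 2 * \<epsilon>"
        by (rule norm_bound) (simp add: \<phi> \<psi> idx close that)
      then show ?thesis using \<delta> by (simp add: \<epsilon>_def)
    qed
    moreover have "range \<phi> \<subseteq> linf d"
      by (auto simp: linf_def \<phi>)
    moreover have "clinear_on UNIV \<phi>" "clinear_on (linf d) \<psi>"
      by (auto simp: clinear_on_def \<phi> \<psi> apply_bcontfun_scaleC scaleC_complex_def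
          intro!: bcontfun_eqI)
    moreover have "contractive_on UNIV \<phi>" "contractive_on (linf d) \<psi>"
      by (auto simp: contractive_on_def \<phi> \<psi> intro!: norm_bound norm_bounded)
    ultimately have "(\<phi>, \<psi>, d) \<in> CA (\<lambda>x. x) \<Omega> \<delta>"
      using d by (simp add: CA_def)
    then show ?thesis by blast
  qed
  then show ?thesis
    by (simp add: CA_embedding_def clinear_on_def)
qed

text \<open>
  The following quantities carry the CA embedding as an explicit argument.  They do not depend on
  it, but the type of its codomain is not determined by the type of its domain, so it cannot be
  quantified away inside a definition.
\<close>

definition rc :: "('a::complex_banach \<Rightarrow> 'b::complex_banach) \<Rightarrow> 'a set \<Rightarrow> real \<Rightarrow> nat"
  where "rc \<iota> \<Omega> \<delta> = Inf {d. \<exists>\<phi> \<psi>. (\<phi>, \<psi>, d) \<in> CA \<iota> \<Omega> \<delta>}"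

definition hc3 :: "('a::complex_banach \<Rightarrow> 'b::complex_banach) \<Rightarrow> ('a \<Rightarrow> 'a) \<Rightarrow> 'a set \<Rightarrow> real \<Rightarrow> ereal"
  where "hc3 \<iota> \<alpha> \<Omega> \<delta> =
    limsup (\<lambda>n. ereal (1 / real n * ln (real (rc \<iota> (\<Union>k<n. (\<alpha> ^^ k) ` \<Omega>) \<delta>))))"

definition hc2 :: "('a::complex_banach \<Rightarrow> 'b::complex_banach) \<Rightarrow> ('a \<Rightarrow> 'a) \<Rightarrow> 'a set \<Rightarrow> ereal"
  where "hc2 \<iota> \<alpha> \<Omega> = (SUP \<delta>\<in>{0<..}. hc3 \<iota> \<alpha> \<Omega> \<delta>)"

definition hc :: "('a::complex_banach \<Rightarrow> 'b::complex_banach) \<Rightarrow> ('a \<Rightarrow> 'a) \<Rightarrow> ereal"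
  where "hc \<iota> \<alpha> = (SUP \<Omega>\<in>{\<Omega>. finite \<Omega>}. hc2 \<iota> \<alpha> \<Omega>)"

section \<open>Permutations of the integers\<close>

definition associated_permutation ::
    "((int \<Rightarrow>\<^sub>C complex) \<Rightarrow> (int \<Rightarrow>\<^sub>C complex)) \<Rightarrow> (int \<Rightarrow> int) \<Rightarrow> bool"
  where "associated_permutation \<alpha> \<sigma> \<longleftrightarrow> bij \<sigma> \<and>
    (\<exists>l :: int \<Rightarrow> complex. (\<forall>s. cmod (l s) = 1) \<and>
      (\<forall>x s. apply_bcontfun (\<alpha> x) s = l s * apply_bcontfun x (\<sigma> s)))"

text \<open>
  The orbit under the whole group generated by \<open>\<sigma>\<close>, negative powers included, whereas
  the library's \<open>orbit\<close> consists of the forward iterates only.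
\<close>

definition perm_orbit :: "('a \<Rightarrow> 'a) \<Rightarrow> 'a \<Rightarrow> 'a set"
  where "perm_orbit \<sigma> s = {t. \<exists>n::nat. t = (\<sigma> ^^ n) s \<or> t = (inv \<sigma> ^^ n) s}"

definition bounded_orbits :: "('a \<Rightarrow> 'a) \<Rightarrow> bool"
  where "bounded_orbits \<sigma> \<longleftrightarrow>
    (\<exists>N::nat. \<forall>s. finite (perm_orbit \<sigma> s) \<and> card (perm_orbit \<sigma> s) \<le> N)"

end

theory Submission
  imports Defs
begin

text \<open>
  An automorphism with associated permutation \<open>\<sigma>\<close> sends \<open>x\<close> to a unimodular multiple of
  \<open>x \<circ> \<sigma>\<close>, and so do its powers, with \<open>\<sigma>\<close> replaced by its powers.

  Bounded orbits: a common multiple \<open>M\<close> of the orbit sizes makes \<open>\<alpha> ^^ M\<close> the multiplication by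
  a function \<open>l\<close> into the circle. The first \<open>n\<close> images of \<open>\<Omega>\<close> are then of the form
  \<open>l ^ q * y\<close> with \<open>q < n\<close> and \<open>y\<close> in a fixed finite set. All of these are nearly constant on
  the pieces of a partition of the integers that fixes the values of the functions \<open>y\<close> up to a
  constant error and those of \<open>l\<close> up to an error of order \<open>1/n\<close>. Sampling one point in each piece
  approximates them through as many coordinates as there are pieces, and \<open>O(n\<^sup>2)\<close> pieces suffice
  (\<open>rc_multiplication_powers_le\<close>). Polynomial growth means entropy zero.

  Unbounded orbits: there are pairwise disjoint injective orbit segments of all prescribed
  lengths (\<open>unbounded_orbits_disjoint_segments\<close>), enough to assign one to each of the countably many
  finite sign patterns. Writing the pattern, corrected by the unimodular factors, along its segment
  defines functions \<open>f 0, f 1, \<dots>\<close> in the unit ball such that for all \<open>m\<close> and \<open>n\<close> every signed sum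
  of the \<open>m * n\<close> functions \<open>(\<alpha> ^^ k) (f j)\<close>, \<open>k < n\<close>, \<open>j < m\<close>, has norm at least \<open>m * n\<close>.
  If such a family is approximated through \<open>d\<close> coordinates, then each of the \<open>2 ^ (m * n)\<close> signed sums
  must be large in one of them; but in a single coordinate only an exponentially small
  proportion of the signed sums of numbers of modulus at most one is large, by a Chernoff bound.
  Hence \<open>d\<close> is at least \<open>c ^ (m * n) / 4\<close> with a constant \<open>c > 1\<close>
  (\<open>rc_ge_of_signed_sums\<close>), so that the entropy is at least \<open>m * ln c\<close> for every \<open>m\<close>.
\<close>

section \<open>Bounded functions on discrete spaces\<close>

lemma apply_Bcontfun_discrete:
  fixes f :: "'i::discrete_topology \<Rightarrow> complex"
  assumes "\<And>s. cmod (f s) \<le> B"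
  shows "apply_bcontfun (Bcontfun f) = f"
  by (rule Bcontfun_inverse, rule bcontfun_normI[OF _ assms]) simp

lemma apply_bcontfun_sum:
  "apply_bcontfun (sum f A) s = (\<Sum>i\<in>A. apply_bcontfun (f i) s)"
  by (induction A rule: infinite_finite_induct) auto

lemma clinear_on_sum:
  assumes f: "clinear_on S f" and "0 \<in> S" "\<And>x y. x \<in> S \<Longrightarrow> y \<in> S \<Longrightarrow> x + y \<in> S"
    and g: "\<And>i. i \<in> I \<Longrightarrow> g i \<in> S"
  shows "f (\<Sum>i\<in>I. g i) = (\<Sum>i\<in>I. f (g i))"
proof -
  have f0: "f 0 = 0"
    using f assms(2) unfolding clinear_on_def by (metis add_cancel_right_right)
  have "(\<Sum>i\<in>I. g i) \<in> S \<and> f (\<Sum>i\<in>I. g i) = (\<Sum>i\<in>I. f (g i))"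
    using g
    by (induction I rule: infinite_finite_induct)
      (use assms(2,3) f f0 in \<open>auto simp: clinear_on_def\<close>)
  then show ?thesis by blast
qed

lemma clinear_on_scaleR:
  assumes "clinear_on S f" "x \<in> S"
  shows "f (r *\<^sub>R x) = r *\<^sub>R f x"
  using assms unfolding clinear_on_def by (metis scaleC_of_real)

section \<open>Bounds on the contractive rank\<close>

lemma rc_attained:
  assumes "CA_embedding \<iota>" "finite \<Omega>" "\<delta> > 0"
  obtains \<phi> \<psi> where "(\<phi>, \<psi>, rc \<iota> \<Omega> \<delta>) \<in> CA \<iota> \<Omega> \<delta>"
proof -
  obtain \<phi> \<psi> d where "(\<phi>, \<psi>, d) \<in> CA \<iota> \<Omega> \<delta>"
    using assms unfolding CA_embedding_def by fastforce
  then have "{d. \<exists>\<phi> \<psi>. (\<phi>, \<psi>, d) \<in> CA \<iota> \<Omega> \<delta>} \<noteq> {}" by blast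
  from Inf_nat_def1[OF this] show ?thesis
    using that unfolding rc_def by blast
qed

lemma rc_pos:
  assumes "CA_embedding \<iota>" "finite \<Omega>" "\<delta> > 0"
  shows "rc \<iota> \<Omega> \<delta> > 0"
  by (rule rc_attained[OF assms]) (auto simp: CA_def)

text \<open>
  Replacing \<open>x\<close> by its values at one representative of each fibre of \<open>g\<close> factors an approximate
  identity through the fibres: \<open>\<phi>\<close> samples at the representatives and \<open>\<psi>\<close> spreads each sample over its
  fibre. Composing \<open>\<psi>\<close> with \<open>\<iota>\<close> shows that the bound holds for every isometric embedding.
\<close>

lemma rc_le_card_range:
  fixes g :: "int \<Rightarrow> 'c" and \<iota> :: "(int \<Rightarrow>\<^sub>C complex) \<Rightarrow> 'b::complex_banach"
  assumes \<iota>: "clinear_on UNIV \<iota>" "\<And>x. norm (\<iota> x) = norm x"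
    and fin: "finite (range g)"
    and close: "\<And>x s t. x \<in> \<Omega> \<Longrightarrow> g s = g t \<Longrightarrow> cmod (apply_bcontfun x s - apply_bcontfun x t) \<le> \<epsilon>"
    and "\<epsilon> < \<delta>"
  shows "rc \<iota> \<Omega> \<delta> \<le> card (range g)"
proof -
  define d where "d = card (range g)"
  obtain f :: "'c \<Rightarrow> nat" where f: "bij_betw f (range g) {0..<d}"
    using ex_bij_betw_finite_nat[OF fin] unfolding d_def by blast
  define idx where "idx s = f (g s)" for s
  define rep where "rep = inv idx"
  have idx: "idx s < d" for s
    using bij_betw_imp_surj_on[OF f] unfolding idx_def by fastforce
  have "idx (rep (idx s)) = idx s" for s
    by (simp add: rep_def f_inv_into_f)
  then have rep: "g (rep (idx s)) = g s" for s
    using bij_betw_imp_inj_on[OF f] by (metis idx_def inj_onD rangeI)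
  define \<phi> :: "(int \<Rightarrow>\<^sub>C complex) \<Rightarrow> nat \<Rightarrow>\<^sub>C complex"
    where "\<phi> x = Bcontfun (\<lambda>i. if i < d then apply_bcontfun x (rep i) else 0)" for x
  define \<psi> :: "(nat \<Rightarrow>\<^sub>C complex) \<Rightarrow> int \<Rightarrow>\<^sub>C complex"
    where "\<psi> v = Bcontfun (\<lambda>s. apply_bcontfun v (idx s))" for v
  have \<phi>: "apply_bcontfun (\<phi> x) = (\<lambda>i. if i < d then apply_bcontfun x (rep i) else 0)" for x
    unfolding \<phi>_def by (rule apply_Bcontfun_discrete[of _ "norm x"]) (simp add: norm_bounded)
  have \<psi>: "apply_bcontfun (\<psi> v) = (\<lambda>s. apply_bcontfun v (idx s))" for v
    unfolding \<psi>_def by (rule apply_Bcontfun_discrete[of _ "norm v"]) (simp add: norm_bounded)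
  have \<iota>_diff: "\<iota> x - \<iota> y = \<iota> (x - y)" for x y
    using \<iota>(1) unfolding clinear_on_def by (metis UNIV_I add_diff_cancel_right' diff_add_cancel)
  have "norm (\<iota> (\<psi> (\<phi> x)) - \<iota> x) < \<delta>" if "x \<in> \<Omega>" for x
  proof -
    have "norm (\<psi> (\<phi> x) - x) \<le> \<epsilon>"
      by (rule norm_bound) (simp add: \<phi> \<psi> idx close that rep)
    then show ?thesis using \<open>\<epsilon> < \<delta>\<close> by (simp add: \<iota>_diff \<iota>)
  qed
  moreover have "range \<phi> \<subseteq> linf d"
    by (auto simp: linf_def \<phi>)
  moreover have "clinear_on UNIV \<phi>" and "clinear_on (linf d) \<psi>"
    by (auto simp: clinear_on_def \<phi> \<psi> apply_bcontfun_scaleC scaleC_complex_def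
        intro!: bcontfun_eqI)
  moreover have "clinear_on (linf d) (\<iota> \<circ> \<psi>)"
    using \<open>clinear_on (linf d) \<psi>\<close> \<iota>(1) by (simp add: clinear_on_def)
  moreover have "contractive_on UNIV \<phi>" "contractive_on (linf d) (\<iota> \<circ> \<psi>)"
    by (auto simp: contractive_on_def \<phi> \<psi> \<iota> intro!: norm_bound norm_bounded)
  moreover have "0 < d" using idx[of 0] by simp
  ultimately have "(\<phi>, \<iota> \<circ> \<psi>, d) \<in> CA \<iota> \<Omega> \<delta>"
    by (simp add: CA_def)
  then show ?thesis
    unfolding rc_def d_def by (intro cInf_lower) auto
qed

definition pm_sign :: "'i set \<Rightarrow> 'i \<Rightarrow> real"
  where "pm_sign A i = (if i \<in> A then 1 else - 1)"

lemma abs_pm_sign: "\<bar>pm_sign A i\<bar> = 1"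
  by (simp add: pm_sign_def)

text \<open>
  This sum is \<open>2 ^ card I\<close> times the moment generating function of the random signed sum
  at parameter 1; it factors because the signs are independent.
\<close>

lemma sum_exp_signed_le:
  fixes a :: "'i \<Rightarrow> real"
  assumes "finite I" and a: "\<And>i. i \<in> I \<Longrightarrow> \<bar>a i\<bar> \<le> 1"
  shows "(\<Sum>A\<in>Pow I. exp (\<Sum>i\<in>I. pm_sign A i * a i)) \<le> (2 * cosh 1) ^ card I"
proof -
  have "exp (\<Sum>i\<in>I. pm_sign A i * a i) = (\<Prod>i\<in>A. exp (a i)) * (\<Prod>i\<in>I - A. exp (- a i))"
    if "A \<in> Pow I" for A
  proof -
    have "(\<Sum>i\<in>I. pm_sign A i * a i) = (\<Sum>i\<in>A. a i) + (\<Sum>i\<in>I - A. - a i)"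
      using that \<open>finite I\<close>
      by (subst sum.subset_diff[of A I]) (auto simp: pm_sign_def intro!: arg_cong2[of _ _ _ _ plus] sum.cong)
    then show ?thesis
      using that \<open>finite I\<close> finite_subset[of A I] by (simp add: exp_add exp_sum del: sum_negf)
  qed
  then have "(\<Sum>A\<in>Pow I. exp (\<Sum>i\<in>I. pm_sign A i * a i)) = (\<Prod>i\<in>I. exp (a i) + exp (- a i))"
    using \<open>finite I\<close> by (simp add: prod_add)
  also have "\<dots> = (\<Prod>i\<in>I. 2 * cosh (a i))"
    by (intro prod.cong) (simp_all add: cosh_field_def)
  also have "\<dots> \<le> (\<Prod>i\<in>I. 2 * cosh 1)"
  proof (rule prod_mono)
    fix i assume "i \<in> I"
    then have "cosh \<bar>a i\<bar> \<le> cosh 1"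
      using a by (subst cosh_real_nonneg_le_iff) auto
    then show "0 \<le> 2 * cosh (a i) \<and> 2 * cosh (a i) \<le> 2 * cosh 1"
      by (simp add: cosh_real_nonneg)
  qed
  finally show ?thesis by simp
qed

text \<open>
  Markov's inequality for the exponential moment. The base on the right is less than 2,
  so these sign patterns are an exponentially small proportion of all.
\<close>

lemma card_large_signed_sum:
  fixes a :: "'i \<Rightarrow> real"
  assumes "finite I" and "\<And>i. i \<in> I \<Longrightarrow> \<bar>a i\<bar> \<le> 1"
  shows "real (card {A \<in> Pow I. (\<Sum>i\<in>I. pm_sign A i * a i) \<ge> card I / 2})
    \<le> (2 * cosh 1 * exp (- 1 / 2)) ^ card I"
proof -
  let ?S = "{A \<in> Pow I. (\<Sum>i\<in>I. pm_sign A i * a i) \<ge> card I / 2}"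
  have "card ?S * exp (card I / 2) = (\<Sum>A\<in>?S. exp (card I / 2))" by simp
  also have "\<dots> \<le> (\<Sum>A\<in>?S. exp (\<Sum>i\<in>I. pm_sign A i * a i))"
    by (rule sum_mono) simp
  also have "\<dots> \<le> (\<Sum>A\<in>Pow I. exp (\<Sum>i\<in>I. pm_sign A i * a i))"
    using \<open>finite I\<close> by (intro sum_mono2) auto
  also have "\<dots> \<le> (2 * cosh 1) ^ card I"
    by (rule sum_exp_signed_le[OF assms])
  finally have le: "card ?S * exp (card I / 2) \<le> (2 * cosh 1) ^ card I" .
  have "real (card ?S) = card ?S * exp (card I / 2) * exp (- (card I / 2))"
    by (simp only: mult.assoc exp_minus_inverse mult_1_right)
  also have "\<dots> \<le> (2 * cosh 1) ^ card I * exp (- (card I / 2))"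
    using le by (rule mult_right_mono) simp
  also have "exp (- (card I / 2)) = exp (- 1 / 2) ^ card I"
    by (simp add: exp_of_nat_mult[symmetric])
  finally show ?thesis by (simp add: power_mult_distrib)
qed

text \<open>
  As \<open>3 / 4 > 1 / sqrt 2\<close>, a complex number of modulus at least \<open>3 / 4 * r\<close> has a coordinate of
  absolute value at least \<open>r / 2\<close>. This reduces large complex signed sums to four families of
  large real ones.
\<close>

lemma cmod_ge_cases:
  assumes "cmod z \<ge> 3 / 4 * r" "r \<ge> 0"
  shows "Re z \<ge> r / 2 \<or> - Re z \<ge> r / 2 \<or> Im z \<ge> r / 2 \<or> - Im z \<ge> r / 2"
proof (rule ccontr)
  assume *: "\<not> ?thesis"
  then have "\<bar>Re z\<bar> < r / 2" "\<bar>Im z\<bar> < r / 2" by auto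
  then have "(Re z)\<^sup>2 < (r / 2)\<^sup>2" "(Im z)\<^sup>2 < (r / 2)\<^sup>2"
    using power_strict_mono[of "\<bar>Re z\<bar>" "r / 2" 2] power_strict_mono[of "\<bar>Im z\<bar>" "r / 2" 2]
    by auto
  then have "(Re z)\<^sup>2 + (Im z)\<^sup>2 < r\<^sup>2 / 2"
    by (simp add: power_divide)
  also have "\<dots> \<le> (3 / 4 * r)\<^sup>2"
    by (simp add: power_mult_distrib power_divide)
  finally have "(cmod z)\<^sup>2 < (3 / 4 * r)\<^sup>2"
    by (simp add: cmod_power2)
  moreover have "(3 / 4 * r)\<^sup>2 \<le> (cmod z)\<^sup>2"
    by (rule power_mono) (use assms in auto)
  ultimately show False by linarith
qed

text \<open>
  The ratio of 2 to the base in the Chernoff bound, hence the rate at which the number of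
  coordinates has to grow.
\<close>

definition growth_base :: real
  where "growth_base = exp (1 / 2) / cosh 1"

lemma growth_base_gt_1: "growth_base > 1"
proof -
  have "exp 1 \<ge> (2::real)" using exp_ge_add_one_self[of 1] by simp
  then have "exp (- 1) \<le> (1 / 2 :: real)" by (simp add: exp_minus field_simps)
  then have "cosh 1 < (1.61 :: real)"
    using e_less_272 by (simp add: cosh_def)
  also have "1.61 < exp (1 / 2 :: real)"
    using exp_lower_Taylor_quadratic[of "1 / 2"] by (simp add: power2_eq_square)
  finally show ?thesis by (simp add: growth_base_def cosh_real_pos)
qed

lemma card_large_complex_signed_sum:
  fixes v :: "'i \<Rightarrow> complex"
  assumes "finite I" and "\<And>i. i \<in> I \<Longrightarrow> cmod (v i) \<le> 1"
  shows "card {A \<in> Pow I. cmod (\<Sum>i\<in>I. pm_sign A i *\<^sub>R v i) \<ge> 3 / 4 * card I}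
    \<le> 4 * (2 / growth_base) ^ card I"
proof -
  define S where "S a = {A \<in> Pow I. (\<Sum>i\<in>I. pm_sign A i * a i) \<ge> card I / 2}" for a
  have S: "real (card (S a)) \<le> (2 / growth_base) ^ card I" if "\<And>i. i \<in> I \<Longrightarrow> \<bar>a i\<bar> \<le> 1" for a
    using card_large_signed_sum[of I a, OF \<open>finite I\<close> that]
    by (simp add: S_def growth_base_def exp_minus field_simps)
  have [simp]: "finite (S a)" for a using \<open>finite I\<close> by (simp add: S_def)
  let ?R = "\<lambda>i. Re (v i)" and ?J = "\<lambda>i. Im (v i)"
  let ?mR = "\<lambda>i. - Re (v i)" and ?mJ = "\<lambda>i. - Im (v i)"
  have sub: "{A \<in> Pow I. cmod (\<Sum>i\<in>I. pm_sign A i *\<^sub>R v i) \<ge> 3 / 4 * card I}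
      \<subseteq> S ?R \<union> S ?mR \<union> S ?J \<union> S ?mJ"
  proof
    fix A assume "A \<in> {A \<in> Pow I. cmod (\<Sum>i\<in>I. pm_sign A i *\<^sub>R v i) \<ge> 3 / 4 * card I}"
    then show "A \<in> S ?R \<union> S ?mR \<union> S ?J \<union> S ?mJ"
      using cmod_ge_cases[of "card I" "\<Sum>i\<in>I. pm_sign A i *\<^sub>R v i"]
      by (auto simp: S_def sum_negf)
  qed
  have "\<bar>Re (v i)\<bar> \<le> 1" "\<bar>Im (v i)\<bar> \<le> 1" if "i \<in> I" for i
    using assms(2)[OF that] abs_Re_le_cmod[of "v i"] abs_Im_le_cmod[of "v i"] by linarith+
  then have b: "real (card (S ?R)) \<le> (2 / growth_base) ^ card I" "real (card (S ?mR)) \<le> (2 / growth_base) ^ card I"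
    "real (card (S ?J)) \<le> (2 / growth_base) ^ card I" "real (card (S ?mJ)) \<le> (2 / growth_base) ^ card I"
    by (auto intro!: S)
  have "card {A \<in> Pow I. cmod (\<Sum>i\<in>I. pm_sign A i *\<^sub>R v i) \<ge> 3 / 4 * card I}
      \<le> card (S ?R \<union> S ?mR \<union> S ?J \<union> S ?mJ)"
    by (rule card_mono[OF _ sub]) simp
  also have "\<dots> \<le> card (S ?R) + card (S ?mR) + card (S ?J) + card (S ?mJ)"
    by (meson add_right_mono card_Un_le le_trans)
  finally show ?thesis using b by linarith
qed

text \<open>
  If \<open>\<psi> \<circ> \<phi>\<close> is within \<open>1 / 4\<close> of \<open>\<iota>\<close> on each \<open>x i\<close>, it is within \<open>card I / 4\<close> on a signed sum.
  So \<open>\<phi>\<close> maps each of the \<open>2 ^ card I\<close> signed sums to a vector that has a coordinate of modulus at least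
  \<open>3 / 4 * card I\<close>, whereas each coordinate can serve only few sign patterns.
\<close>

lemma rc_ge_of_signed_sums:
  fixes \<iota> :: "'a::complex_banach \<Rightarrow> 'b::complex_banach"
  assumes \<iota>: "CA_embedding \<iota>" and I: "finite I"
    and x: "\<And>i. i \<in> I \<Longrightarrow> norm (x i) \<le> 1"
    and sums: "\<And>A. A \<subseteq> I \<Longrightarrow> norm (\<Sum>i\<in>I. pm_sign A i *\<^sub>R x i) \<ge> card I"
  shows "real (rc \<iota> (x ` I) (1 / 4)) \<ge> growth_base ^ card I / 4"
proof -
  define d where "d = rc \<iota> (x ` I) (1 / 4)"
  obtain \<phi> \<psi> where "(\<phi>, \<psi>, d) \<in> CA \<iota> (x ` I) (1 / 4)"
    using rc_attained[OF \<iota>, of "x ` I" "1 / 4"] I unfolding d_def by auto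
  then have d: "0 < d" and \<phi>: "\<And>y. \<phi> y \<in> linf d" "clinear_on UNIV \<phi>" "\<And>y. norm (\<phi> y) \<le> norm y"
    and \<psi>: "clinear_on (linf d) \<psi>" "\<And>v. v \<in> linf d \<Longrightarrow> norm (\<psi> v) \<le> norm v"
    and close: "\<And>i. i \<in> I \<Longrightarrow> norm (\<psi> (\<phi> (x i)) - \<iota> (x i)) < 1 / 4"
    by (auto simp: CA_def contractive_on_def)
  have \<iota>': "clinear_on UNIV \<iota>" "\<And>y. norm (\<iota> y) = norm y"
    using \<iota> by (auto simp: CA_embedding_def)
  have lin: "f (\<Sum>i\<in>I. r i *\<^sub>R y i) = (\<Sum>i\<in>I. r i *\<^sub>R f (y i))" if "clinear_on UNIV f"
    for f :: "'a \<Rightarrow> 'z::complex_banach" and r y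
    by (simp add: clinear_on_sum[OF that] clinear_on_scaleR[OF that])
  have linf: "0 \<in> linf d" "\<And>u v. u \<in> linf d \<Longrightarrow> v \<in> linf d \<Longrightarrow> u + v \<in> linf d"
      "\<And>r u. u \<in> linf d \<Longrightarrow> r *\<^sub>R u \<in> linf d"
    by (auto simp: linf_def)
  define S where "S j = {A \<in> Pow I. cmod (\<Sum>i\<in>I. pm_sign A i *\<^sub>R apply_bcontfun (\<phi> (x i)) j) \<ge> 3 / 4 * card I}" for j
  have "Pow I \<subseteq> (\<Union>j<d. S j)"
  proof
    fix A assume A: "A \<in> Pow I"
    define u where "u = \<phi> (\<Sum>i\<in>I. pm_sign A i *\<^sub>R x i)"
    have u: "u = (\<Sum>i\<in>I. pm_sign A i *\<^sub>R \<phi> (x i))"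
      unfolding u_def by (rule lin[OF \<phi>(2)])
    have "\<psi> u = (\<Sum>i\<in>I. pm_sign A i *\<^sub>R \<psi> (\<phi> (x i)))"
      unfolding u by (simp add: clinear_on_sum[OF \<psi>(1)] linf \<phi>(1) clinear_on_scaleR[OF \<psi>(1)])
    then have "\<iota> (\<Sum>i\<in>I. pm_sign A i *\<^sub>R x i) - \<psi> u
        = (\<Sum>i\<in>I. pm_sign A i *\<^sub>R (\<iota> (x i) - \<psi> (\<phi> (x i))))"
      by (simp add: lin[OF \<iota>'(1)] sum_subtractf scaleR_diff_right)
    also have "norm \<dots> \<le> (\<Sum>i\<in>I. 1 / 4)"
      by (rule sum_norm_le)
        (use close in \<open>auto simp: abs_pm_sign norm_minus_commute intro: less_imp_le\<close>)
    finally have "norm (\<iota> (\<Sum>i\<in>I. pm_sign A i *\<^sub>R x i) - \<psi> u) \<le> card I / 4" by simp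
    moreover have "norm (\<iota> (\<Sum>i\<in>I. pm_sign A i *\<^sub>R x i)) \<ge> card I"
      using sums A by (simp add: \<iota>')
    ultimately have "norm (\<psi> u) \<ge> 3 / 4 * card I"
      using norm_triangle_ineq2[of "\<iota> (\<Sum>i\<in>I. pm_sign A i *\<^sub>R x i)" "\<psi> u"] by linarith
    moreover have "u \<in> linf d" by (simp add: u_def \<phi>)
    ultimately have nu: "norm u \<ge> 3 / 4 * card I"
      using \<psi>(2) by fastforce
    define m where "m = Max ((\<lambda>j. cmod (apply_bcontfun u j)) ` {..<d})"
    have "m \<in> (\<lambda>j. cmod (apply_bcontfun u j)) ` {..<d}"
      unfolding m_def using d by (intro Max_in) auto
    then obtain j where j: "j < d" "m = cmod (apply_bcontfun u j)" by auto
    have "cmod (apply_bcontfun u i) \<le> m" for i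
    proof (cases "i < d")
      case True
      then show ?thesis unfolding m_def by (intro Max_ge) auto
    next
      case False
      then show ?thesis using \<open>u \<in> linf d\<close> j(2) by (simp add: linf_def)
    qed
    then have "norm u \<le> m" by (rule norm_bound)
    then have "A \<in> S j"
      using nu j A unfolding S_def u by (simp add: apply_bcontfun_sum)
    then show "A \<in> (\<Union>j<d. S j)" using j by blast
  qed
  then have "card (Pow I) \<le> card (\<Union>j<d. S j)"
    using I by (intro card_mono) (auto simp: S_def)
  also have "\<dots> \<le> (\<Sum>j<d. card (S j))"
    by (rule card_UN_le) simp
  finally have "2 ^ card I \<le> (\<Sum>j<d. real (card (S j)))"
    using I by (simp add: card_Pow flip: of_nat_sum)
  also have "\<dots> \<le> (\<Sum>j<d. 4 * (2 / growth_base) ^ card I)"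
    unfolding S_def
    by (intro sum_mono card_large_complex_signed_sum I)
      (meson norm_bounded \<phi>(3) x order_trans)
  finally have "2 ^ card I \<le> d * 4 * (2 / growth_base) ^ card I" by simp
  then show ?thesis
    using growth_base_gt_1 unfolding d_def[symmetric] by (simp add: field_simps)
qed

section \<open>Iterates and orbits\<close>

lemma associated_permutation_funpow:
  assumes "associated_permutation \<alpha> \<sigma>"
  shows "associated_permutation (\<alpha> ^^ k) (\<sigma> ^^ k)"
proof (induction k)
  case 0
  show ?case by (auto simp: associated_permutation_def bij_id[unfolded id_def] intro!: exI[of _ "\<lambda>_. 1"])
next
  case (Suc k)
  from assms obtain l where l: "bij \<sigma>" "\<And>s. cmod (l s) = 1"
    "\<And>x s. apply_bcontfun (\<alpha> x) s = l s * apply_bcontfun x (\<sigma> s)"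
    by (auto simp: associated_permutation_def)
  from Suc obtain L where L: "bij (\<sigma> ^^ k)" "\<And>s. cmod (L s) = 1"
    "\<And>x s. apply_bcontfun ((\<alpha> ^^ k) x) s = L s * apply_bcontfun x ((\<sigma> ^^ k) s)"
    by (auto simp: associated_permutation_def)
  have "bij (\<sigma> ^^ Suc k)" using l(1) by (rule bij_fn)
  moreover have "\<forall>s. cmod (l s * L (\<sigma> s)) = 1"
    by (simp add: l L norm_mult)
  moreover have "apply_bcontfun ((\<alpha> ^^ Suc k) x) s
      = l s * L (\<sigma> s) * apply_bcontfun x ((\<sigma> ^^ Suc k) s)" for x s
    by (simp add: l L funpow_swap1[of \<sigma>])
  ultimately show ?case
    unfolding associated_permutation_def by (intro conjI exI[of _ "\<lambda>s. l s * L (\<sigma> s)"]) auto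
qed

lemma bounded_orbits_common_period:
  assumes "bij \<sigma>" "bounded_orbits \<sigma>"
  obtains M where "M > 0" "\<sigma> ^^ M = id"
proof -
  obtain N where N: "\<And>s. finite (perm_orbit \<sigma> s)" "\<And>s. card (perm_orbit \<sigma> s) \<le> N"
    using assms(2) by (auto simp: bounded_orbits_def)
  \<comment> \<open>Every point has a period of at most \<open>N\<close>, and each number in \<open>{1..N}\<close> divides \<open>fact N\<close>.\<close>
  have "(\<sigma> ^^ fact N) s = s" for s
  proof -
    have "(\<lambda>k. (\<sigma> ^^ k) s) ` {..N} \<subseteq> perm_orbit \<sigma> s"
      by (auto simp: perm_orbit_def)
    then have "card ((\<lambda>k. (\<sigma> ^^ k) s) ` {..N}) \<le> N"
      using N card_mono order_trans by meson
    then have "\<not> inj_on (\<lambda>k. (\<sigma> ^^ k) s) {..N}"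
      using card_image by fastforce
    then obtain a b where ab: "a < b" "b \<le> N" "(\<sigma> ^^ a) s = (\<sigma> ^^ b) s"
      unfolding inj_on_def by (metis atMost_iff linorder_neqE_nat)
    have "(\<sigma> ^^ a) ((\<sigma> ^^ (b - a)) s) = (\<sigma> ^^ a) s"
      using ab by (metis comp_apply funpow_add le_add_diff_inverse less_imp_le)
    then have p: "(\<sigma> ^^ (b - a)) s = s"
      using bij_fn[OF assms(1)] by (metis bij_is_inj injD)
    have "(b - a) dvd fact N" using ab by (intro dvd_fact) auto
    then show ?thesis
      using p by (metis dvd_imp_mod_0 funpow_0 funpow_mod_eq)
  qed
  then show ?thesis using that[of "fact N"] by (auto simp: fun_eq_iff)
qed

text \<open>
  A point with a positive period has its backward iterates among its forward ones, so the
  two-sided orbit is no longer than the period.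
\<close>

lemma perm_orbit_periodic:
  assumes "bij \<sigma>" "(\<sigma> ^^ p) s = s" "p > 0"
  shows "perm_orbit \<sigma> s \<subseteq> (\<lambda>k. (\<sigma> ^^ k) s) ` {..<p}"
proof
  have fwd: "(\<sigma> ^^ n) s \<in> (\<lambda>k. (\<sigma> ^^ k) s) ` {..<p}" for n
    using funpow_mod_eq[OF assms(2), of n] assms(3) by (metis imageI lessThan_iff mod_less_divisor)
  have inv: "(inv \<sigma> ^^ n) ((\<sigma> ^^ n) t) = t" for n t
    using bij_is_inj[OF assms(1)] by (induction n arbitrary: t) (simp_all add: funpow_swap1)
  fix t assume "t \<in> perm_orbit \<sigma> s"
  then obtain n where "t = (\<sigma> ^^ n) s \<or> t = (inv \<sigma> ^^ n) s" by (auto simp: perm_orbit_def)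
  then show "t \<in> (\<lambda>k. (\<sigma> ^^ k) s) ` {..<p}"
  proof
    assume "t = (inv \<sigma> ^^ n) s"
    also have "s = (\<sigma> ^^ (p * n)) s"
      using assms(2) by (metis funpow_mod_eq mod_mult_self1_is_0 funpow_0)
    also have "\<dots> = (\<sigma> ^^ n) ((\<sigma> ^^ (p * n - n)) s)"
      using assms(3) by (metis comp_apply funpow_add le_add_diff_inverse mult_le_mono1 mult_1 Suc_leI One_nat_def)
    finally show ?thesis using fwd by (simp add: inv)
  qed (use fwd in simp)
qed

lemma period_of_orbit_point:
  assumes "bij \<sigma>" "t \<in> perm_orbit \<sigma> s" "(\<sigma> ^^ p) t = t"
  shows "(\<sigma> ^^ p) s = s"
proof -
  from assms(2) obtain n where "t = (\<sigma> ^^ n) s \<or> t = (inv \<sigma> ^^ n) s"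
    by (auto simp: perm_orbit_def)
  then show ?thesis
  proof
    assume "t = (\<sigma> ^^ n) s"
    then have "(\<sigma> ^^ n) ((\<sigma> ^^ p) s) = (\<sigma> ^^ n) s"
      using assms(3) by (metis add.commute comp_apply funpow_add)
    then show ?thesis using bij_fn[OF assms(1)] by (metis bij_is_inj injD)
  next
    have "(\<sigma> ^^ n) ((inv \<sigma> ^^ n) u) = u" for u
      using bij_is_surj[OF assms(1)]
      by (induction n arbitrary: u) (simp_all add: funpow_swap1 surj_f_inv_f)
    moreover assume "t = (inv \<sigma> ^^ n) s"
    ultimately have "s = (\<sigma> ^^ n) t" by simp
    then show ?thesis
      using assms(3) by (metis add.commute comp_apply funpow_add)
  qed
qed

text \<open>
  In an orbit with more than \<open>n * card F + n\<close> points, at most \<open>n * card F\<close> points reach \<open>F\<close>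
  within fewer than \<open>n\<close> steps; any other point starts a segment that avoids \<open>F\<close>. The segment cannot repeat a
  point, since a period below \<open>n\<close> would bound the size of the orbit.
\<close>

lemma unbounded_orbits_segment:
  assumes "bij \<sigma>" "\<not> bounded_orbits \<sigma>" "finite F"
  obtains t where "inj_on (\<lambda>k. (\<sigma> ^^ k) t) {..<n}" "\<And>k. k < n \<Longrightarrow> (\<sigma> ^^ k) t \<notin> F"
proof -
  define N where "N = n * card F + n"
  obtain s where s: "finite (perm_orbit \<sigma> s) \<Longrightarrow> N < card (perm_orbit \<sigma> s)"
    using assms(2) unfolding bounded_orbits_def by (meson not_le)
  then obtain S where S: "S \<subseteq> perm_orbit \<sigma> s" "finite S" "card S = Suc N"
    by (metis Suc_leI infinite_arbitrarily_large obtain_subset_with_card_n)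
  define B where "B = (\<Union>k<n. (\<sigma> ^^ k) -` F)"
  have fin: "finite ((\<sigma> ^^ k) -` F)" "card ((\<sigma> ^^ k) -` F) \<le> card F" for k
    using bij_fn[OF assms(1), of k] assms(3)
    by (auto simp: bij_def finite_vimageI card_vimage_inj)
  have "card B \<le> (\<Sum>k<n. card ((\<sigma> ^^ k) -` F))"
    unfolding B_def by (rule card_UN_le) simp
  also have "\<dots> \<le> n * card F"
    using sum_bounded_above[of "{..<n}" "\<lambda>k. card ((\<sigma> ^^ k) -` F)" "card F"] fin by simp
  finally have "card B < card S" using S(3) by (simp add: N_def)
  moreover have "finite B" using fin by (simp add: B_def)
  ultimately obtain t where t: "t \<in> S" "t \<notin> B"
    by (meson card_mono not_le subsetI)
  have "inj_on (\<lambda>k. (\<sigma> ^^ k) t) {..<n}"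
  proof (rule linorder_inj_onI')
    fix a b assume ab: "a \<in> {..<n}" "b \<in> {..<n}" "a < b"
    show "(\<sigma> ^^ a) t \<noteq> (\<sigma> ^^ b) t"
    proof
      assume "(\<sigma> ^^ a) t = (\<sigma> ^^ b) t"
      then have "(\<sigma> ^^ a) ((\<sigma> ^^ (b - a)) t) = (\<sigma> ^^ a) t"
        using ab by (metis comp_apply funpow_add le_add_diff_inverse less_imp_le)
      then have "(\<sigma> ^^ (b - a)) t = t"
        using bij_fn[OF assms(1)] by (metis bij_is_inj injD)
      then have "(\<sigma> ^^ (b - a)) s = s"
        using period_of_orbit_point[OF assms(1)] t S by blast
      then have sub: "perm_orbit \<sigma> s \<subseteq> (\<lambda>k. (\<sigma> ^^ k) s) ` {..<b - a}"
        using perm_orbit_periodic[OF assms(1)] ab by simp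
      then have "card (perm_orbit \<sigma> s) \<le> b - a" "finite (perm_orbit \<sigma> s)"
        using surj_card_le[OF _ sub] finite_subset[OF sub] by auto
      then show False using s ab by (simp add: N_def)
    qed
  qed
  moreover have "(\<sigma> ^^ k) t \<notin> F" if "k < n" for k
    using t that by (auto simp: B_def)
  ultimately show ?thesis using that by blast
qed

text \<open>
  The starting points \<open>s i\<close> are chosen recursively, each segment avoiding the finitely many
  points of the earlier ones.
\<close>

lemma unbounded_orbits_disjoint_segments:
  fixes len :: "nat \<Rightarrow> nat"
  assumes "bij \<sigma>" "\<not> bounded_orbits \<sigma>"
  obtains s where "inj_on (\<lambda>(i, k). (\<sigma> ^^ k) (s i)) (SIGMA i:UNIV. {..<len i})"
proof -
  define P where "P s i t \<longleftrightarrow> inj_on (\<lambda>k. (\<sigma> ^^ k) t) {..<len i} \<and>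
    (\<forall>k<len i. (\<sigma> ^^ k) t \<notin> (\<Union>j<i. (\<lambda>k. (\<sigma> ^^ k) (s j)) ` {..<len j}))" for s :: "nat \<Rightarrow> 'a" and i t
  have "\<exists>s. \<forall>i. P s i (s i)"
  proof (rule dependent_wf_choice[of less_than])
    show "P f i r = P g i r" if "\<And>j. (j, i) \<in> less_than \<Longrightarrow> f j = g j" for f g i r
      using that by (simp add: P_def)
    fix s i
    let ?F = "\<Union>j<i. (\<lambda>k. (\<sigma> ^^ k) (s j)) ` {..<len j}"
    have "finite ?F" by simp
    then obtain t where "inj_on (\<lambda>k. (\<sigma> ^^ k) t) {..<len i}" "\<And>k. k < len i \<Longrightarrow> (\<sigma> ^^ k) t \<notin> ?F"
      by (rule unbounded_orbits_segment[OF assms, where n = "len i"]) blast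
    then have "P s i t" unfolding P_def by blast
    then show "\<exists>t. P s i t" ..
  qed simp
  then obtain s where s: "\<And>i. P s i (s i)" by blast
  have neq: "(\<sigma> ^^ k) (s i) \<noteq> (\<sigma> ^^ k') (s j)" if "j < i" "k < len i" "k' < len j" for i j k k'
    using s[of i] that unfolding P_def by blast
  have "inj_on (\<lambda>(i, k). (\<sigma> ^^ k) (s i)) (SIGMA i:UNIV. {..<len i})"
  proof (rule inj_onI, clarsimp)
    fix i k j k' assume *: "k < len i" "k' < len j" "(\<sigma> ^^ k) (s i) = (\<sigma> ^^ k') (s j)"
    then have "i = j" using neq by (metis linorder_neqE_nat)
    then show "i = j \<and> k = k'" using * s[of i] by (auto simp: P_def inj_on_def)
  qed
  then show ?thesis by (rule that)
qed

section \<open>Unbounded orbits\<close>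

text \<open>
  A single sequence of functions serves all \<open>m\<close>, \<open>n\<close> and \<open>A\<close>: each finite sign pattern has a
  segment of its own, at whose starting point all terms of the signed sum with this pattern
  are equal to 1.
\<close>

lemma unbounded_orbits_generators:
  assumes \<alpha>: "associated_permutation \<alpha> \<sigma>" and unb: "\<not> bounded_orbits \<sigma>"
  obtains f :: "nat \<Rightarrow> int \<Rightarrow>\<^sub>C complex"
  where "\<And>j. norm (f j) \<le> 1"
    and "\<And>m n A. norm (\<Sum>(k, j)\<in>{..<n} \<times> {..<m}. pm_sign A (k, j) *\<^sub>R (\<alpha> ^^ k) (f j)) \<ge> n * m"
proof -
  have bij: "bij \<sigma>" using \<alpha> by (simp add: associated_permutation_def)
  have "\<forall>k. \<exists>L. (\<forall>s. cmod (L s) = 1) \<and>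
      (\<forall>x s. apply_bcontfun ((\<alpha> ^^ k) x) s = L s * apply_bcontfun x ((\<sigma> ^^ k) s))"
    using associated_permutation_funpow[OF \<alpha>] by (simp add: associated_permutation_def)
  then obtain L where L: "\<And>k s. cmod (L k s) = 1"
    "\<And>k x s. apply_bcontfun ((\<alpha> ^^ k) x) s = L k s * apply_bcontfun x ((\<sigma> ^^ k) s)"
    by metis
  \<comment> \<open>The index \<open>i\<close> of a segment encodes a pair: a code of a finite set of pairs \<open>(k, j)\<close>, the
    positions of the positive signs, and the length of the segment.\<close>
  define len where "len i = snd (prod_decode i)" for i
  define pat where "pat i = prod_encode -` set_decode (fst (prod_decode i))" for i
  obtain s where s: "inj_on (\<lambda>(i, k). (\<sigma> ^^ k) (s i)) (SIGMA i:UNIV. {..<len i})"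
    (is "inj_on ?pt ?D")
    using unbounded_orbits_disjoint_segments[OF bij unb] .
  define f where "f j = Bcontfun (\<lambda>t. if t \<in> ?pt ` ?D then
      (case inv_into ?D ?pt t of (i, k) \<Rightarrow> cnj (L k (s i)) * pm_sign (pat i) (k, j)) else 0)" for j
  have f: "apply_bcontfun (f j) = (\<lambda>t. if t \<in> ?pt ` ?D then
      (case inv_into ?D ?pt t of (i, k) \<Rightarrow> cnj (L k (s i)) * pm_sign (pat i) (k, j)) else 0)" for j
    unfolding f_def
    by (rule apply_Bcontfun_discrete[of _ 1]) (auto simp: norm_mult L abs_pm_sign split: prod.split)
  have "norm (f j) \<le> 1" for j
    by (rule norm_bound) (auto simp: f norm_mult L abs_pm_sign split: prod.split)
  moreover have "norm (\<Sum>(k, j)\<in>{..<n} \<times> {..<m}. pm_sign A (k, j) *\<^sub>R (\<alpha> ^^ k) (f j)) \<ge> n * m" for m n A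
  proof -
    define F where "F = (\<Sum>(k, j)\<in>{..<n} \<times> {..<m}. pm_sign A (k, j) *\<^sub>R (\<alpha> ^^ k) (f j))"
    define U where "U = prod_encode ` (A \<inter> {..<n} \<times> {..<m})"
    define i where "i = prod_encode (set_encode U, n)"
    have "finite U" by (simp add: U_def)
    then have "pat i = prod_encode -` U" by (simp add: pat_def i_def)
    also have "\<dots> = A \<inter> {..<n} \<times> {..<m}"
      by (auto simp: U_def image_iff)
    finally have pat: "pm_sign (pat i) (k, j) = pm_sign A (k, j)" if "k < n" "j < m" for k j
      using that by (simp add: pm_sign_def)
    have "pm_sign A (k, j) *\<^sub>R apply_bcontfun ((\<alpha> ^^ k) (f j)) (s i) = 1" if "k < n" "j < m" for k j
    proof -
      have D: "(i, k) \<in> ?D" using that by (simp add: len_def i_def)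
      have "inv_into ?D ?pt (?pt (i, k)) = (i, k)"
        using inv_into_f_f[OF s D] .
      moreover have "?pt (i, k) \<in> ?pt ` ?D" using D by (rule imageI)
      ultimately have "apply_bcontfun (f j) ((\<sigma> ^^ k) (s i)) = cnj (L k (s i)) * pm_sign A (k, j)"
        by (simp add: f pat that)
      moreover have "L k (s i) * cnj (L k (s i)) = 1"
        by (simp add: complex_norm_square[symmetric] L)
      ultimately show ?thesis
        by (simp add: L(2) scaleR_conv_of_real pm_sign_def mult.assoc[symmetric])
    qed
    then have "(\<Sum>p\<in>{..<n} \<times> {..<m}. apply_bcontfun
        (case p of (k, j) \<Rightarrow> pm_sign A (k, j) *\<^sub>R (\<alpha> ^^ k) (f j)) (s i)) = (\<Sum>p\<in>{..<n} \<times> {..<m}. 1)"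
      by (intro sum.cong) auto
    then have "apply_bcontfun F (s i) = of_nat (n * m)"
      unfolding F_def apply_bcontfun_sum by simp
    then have "norm F \<ge> n * m"
      using norm_bounded[of F "s i"] by (simp add: norm_mult)
    then show ?thesis by (simp only: F_def)
  qed
  ultimately show ?thesis by (rule that)
qed

lemma hc_unbounded_orbits:
  assumes "associated_permutation \<alpha> \<sigma>" "CA_embedding \<iota>" "\<not> bounded_orbits \<sigma>"
    and "isometric_automorphism \<alpha>"
  shows "hc \<iota> \<alpha> = \<infinity>"
proof -
  obtain f where f: "\<And>j. norm (f j) \<le> 1"
    "\<And>m n A. norm (\<Sum>(k, j)\<in>{..<n} \<times> {..<m}. pm_sign A (k, j) *\<^sub>R (\<alpha> ^^ k) (f j)) \<ge> n * m"
    using unbounded_orbits_generators[OF assms(1,3)] by blast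
  have norm: "norm ((\<alpha> ^^ k) x) = norm x" for k x
    using assms(4) by (induction k) (auto simp: isometric_automorphism_def)
  have "ereal (real m * ln growth_base) \<le> hc \<iota> \<alpha>" for m
  proof -
    let ?\<Omega> = "f ` {..<m}"
    define a where "a n = ereal (1 / real n * ln (real (rc \<iota> (\<Union>k<n. (\<alpha> ^^ k) ` ?\<Omega>) (1 / 4))))" for n
    have "real m * ln growth_base - ln 4 / n \<le> 1 / real n * ln (real (rc \<iota> (\<Union>k<n. (\<alpha> ^^ k) ` ?\<Omega>) (1 / 4)))"
      if "n > 0" for n
    proof -
      let ?I = "{..<n} \<times> {..<m}"
      let ?R = "rc \<iota> (\<Union>k<n. (\<alpha> ^^ k) ` ?\<Omega>) (1 / 4)"
      have "(\<lambda>(k, j). (\<alpha> ^^ k) (f j)) ` ?I = (\<Union>k<n. (\<alpha> ^^ k) ` ?\<Omega>)" by auto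
      moreover have "growth_base ^ card ?I / 4 \<le> real (rc \<iota> ((\<lambda>(k, j). (\<alpha> ^^ k) (f j)) ` ?I) (1 / 4))"
        using f(2)[of n m] by (intro rc_ge_of_signed_sums assms(2))
          (auto simp: norm f case_prod_unfold)
      ultimately have "growth_base ^ (n * m) / 4 \<le> ?R" by (simp add: card_cartesian_product)
      then have "ln (growth_base ^ (n * m) / 4) \<le> ln ?R"
        using growth_base_gt_1 by (intro ln_mono) auto
      then have "real (n * m) * ln growth_base - ln 4 \<le> ln ?R"
        using growth_base_gt_1 by (simp add: ln_div ln_realpow)
      then have "(real (n * m) * ln growth_base - ln 4) / n \<le> ln ?R / n"
        by (rule divide_right_mono) simp
      then show ?thesis using that by (simp add: diff_divide_distrib)
    qed
    then have "eventually (\<lambda>n. ereal (real m * ln growth_base - ln 4 / real n) \<le> a n) sequentially"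
      unfolding a_def by (intro eventually_mono[OF eventually_gt_at_top[of 0]]) simp
    then have "limsup (\<lambda>n. ereal (real m * ln growth_base - ln 4 / real n)) \<le> limsup a"
      by (rule Limsup_mono)
    moreover have lim: "(\<lambda>n. ereal (real m * ln growth_base - ln 4 / real n)) \<longlonglongrightarrow> ereal (real m * ln growth_base - 0)"
      by (intro tendsto_ereal tendsto_diff tendsto_const lim_const_over_n)
    have "limsup (\<lambda>n. ereal (real m * ln growth_base - ln 4 / real n)) = ereal (real m * ln growth_base)"
      using lim_imp_Limsup[OF sequentially_bot lim] by simp
    ultimately have "ereal (real m * ln growth_base) \<le> hc3 \<iota> \<alpha> ?\<Omega> (1 / 4)"
      unfolding hc3_def a_def by simp
    also have "\<dots> \<le> hc2 \<iota> \<alpha> ?\<Omega>"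
      unfolding hc2_def by (rule SUP_upper) simp
    also have "\<dots> \<le> hc \<iota> \<alpha>"
      unfolding hc_def by (rule SUP_upper) simp
    finally show ?thesis .
  qed
  note le = this
  show ?thesis
  proof (rule ereal_top)
    fix B
    have "ln growth_base > 0" using growth_base_gt_1 by simp
    then obtain m where "B < real m * ln growth_base" using reals_Archimedean3 by blast
    then have "ereal B \<le> ereal (real m * ln growth_base)" by simp
    also have "\<dots> \<le> hc \<iota> \<alpha>" by (rule le)
    finally show "ereal B \<le> hc \<iota> \<alpha>" .
  qed
qed

section \<open>Bounded orbits\<close>

text \<open>
  The integer coordinates of the square that contains \<open>z\<close> in a grid of side length \<open>\<epsilon>\<close>.
\<close>

definition cell :: "real \<Rightarrow> complex \<Rightarrow> int \<times> int"
  where "cell \<epsilon> z = (\<lfloor>Re z / \<epsilon>\<rfloor>, \<lfloor>Im z / \<epsilon>\<rfloor>)"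

lemma dist_le_of_cell_eq:
  assumes "cell \<epsilon> z = cell \<epsilon> w" "\<epsilon> > 0"
  shows "cmod (z - w) \<le> 2 * \<epsilon>"
proof -
  have aux: "\<bar>a - b\<bar> \<le> \<epsilon>" if "\<lfloor>a / \<epsilon>\<rfloor> = \<lfloor>b / \<epsilon>\<rfloor>" for a b
  proof -
    have "\<bar>a / \<epsilon> - b / \<epsilon>\<bar> \<le> 1" using that by linarith
    then have "\<bar>(a - b) / \<epsilon>\<bar> \<le> 1" by (simp add: diff_divide_distrib)
    then show ?thesis using assms(2) by (simp add: abs_divide)
  qed
  show ?thesis
    using aux[of "Re z" "Re w"] aux[of "Im z" "Im w"] cmod_le[of "z - w"] assms(1)
    by (simp add: cell_def)
qed

lemma cell_in_box:
  assumes "cmod z \<le> B" "B \<le> of_int K * \<epsilon>" "\<epsilon> > 0"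
  shows "cell \<epsilon> z \<in> {- K..K} \<times> {- K..K}"
proof -
  have "\<lfloor>a / \<epsilon>\<rfloor> \<in> {- K..K}" if "\<bar>a\<bar> \<le> cmod z" for a
  proof -
    have "\<bar>a\<bar> \<le> of_int K * \<epsilon>" using that assms by linarith
    then have "of_int (- K) \<le> a / \<epsilon>" "a / \<epsilon> \<le> of_int K"
      using assms(3) by (auto simp: field_simps abs_le_iff)
    then show ?thesis by (simp add: le_floor_iff floor_le_iff)
  qed
  then show ?thesis
    using abs_Re_le_cmod abs_Im_le_cmod by (simp add: cell_def)
qed

lemma finite_range_cells:
  fixes \<Omega> :: "(int \<Rightarrow>\<^sub>C complex) set"
  assumes "finite \<Omega>" "\<epsilon> > 0"
  shows "finite (range (\<lambda>s. restrict (\<lambda>x. cell \<epsilon> (apply_bcontfun x s)) \<Omega>))"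
proof -
  define K where "K x = \<lceil>norm x / \<epsilon>\<rceil>" for x :: "int \<Rightarrow>\<^sub>C complex"
  have "cell \<epsilon> (apply_bcontfun x s) \<in> {- K x..K x} \<times> {- K x..K x}" for x s
  proof (rule cell_in_box[OF norm_bounded _ assms(2)])
    have "norm x / \<epsilon> \<le> of_int (K x)" by (simp add: K_def)
    then show "norm x \<le> of_int (K x) * \<epsilon>" using assms(2) by (simp add: field_simps)
  qed
  then have "range (\<lambda>s. restrict (\<lambda>x. cell \<epsilon> (apply_bcontfun x s)) \<Omega>)
      \<subseteq> (\<Pi>\<^sub>E x\<in>\<Omega>. {- K x..K x} \<times> {- K x..K x})" by auto
  moreover have "finite (\<Pi>\<^sub>E x\<in>\<Omega>. {- K x..K x} \<times> {- K x..K x})"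
    using assms(1) by (intro finite_PiE) auto
  ultimately show ?thesis by (rule finite_subset)
qed

text \<open>
  To control \<open>l ^ q\<close> for all \<open>q < n\<close>, the values of \<open>l\<close> have to be known up to \<open>O(1/n)\<close>, as powers
  multiply errors by at most \<open>q\<close>. As \<open>l\<close> takes values in the plane, this costs a number of cells that is
  quadratic in \<open>n\<close>; the functions in \<open>\<Omega>\<close> contribute the constant factor \<open>C\<close>.
\<close>

lemma rc_multiplication_powers_le:
  fixes \<iota> :: "(int \<Rightarrow>\<^sub>C complex) \<Rightarrow> 'b::complex_banach"
  assumes \<iota>: "CA_embedding \<iota>" and fin: "finite \<Omega>" and \<delta>: "\<delta> > 0"
    and l: "\<And>s. cmod (l s) = 1"
  obtains C K :: nat where "\<And>n S. n > 0 \<Longrightarrow>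
    (\<And>x. x \<in> S \<Longrightarrow> \<exists>q<n. \<exists>y\<in>\<Omega>. \<forall>s. apply_bcontfun x s = l s ^ q * apply_bcontfun y s) \<Longrightarrow>
    rc \<iota> S \<delta> \<le> (2 * (K * n) + 1)\<^sup>2 * C"
proof -
  define g where "g s = restrict (\<lambda>x. cell (\<delta> / 8) (apply_bcontfun x s)) \<Omega>" for s
  have g: "finite (range g)"
    unfolding g_def using finite_range_cells[OF fin] \<delta> by simp
  define B where "B = (\<Sum>y\<in>\<Omega>. norm y) + 1"
  have B: "B > 0" "\<And>y. y \<in> \<Omega> \<Longrightarrow> norm y \<le> B"
    using fin unfolding B_def
    by (auto intro!: add_nonneg_pos sum_nonneg add_increasing2 member_le_sum)
  \<comment> \<open>With cells of side \<open>1 / (K * n)\<close> the powers contribute an error of at most \<open>2 * B / K\<close>, which has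
    to be at most \<open>\<delta> / 4\<close>.\<close>
  obtain K :: nat where K0: "8 * B / \<delta> < K" using reals_Archimedean2 by blast
  then have K: "K > 0" using B \<delta> by (metis divide_pos_pos mult_pos_pos of_nat_0_less_iff order_less_trans zero_less_numeral)
  have "rc \<iota> S \<delta> \<le> (2 * (K * n) + 1)\<^sup>2 * card (range g)"
    if n: "n > 0" and S: "\<And>x. x \<in> S \<Longrightarrow> \<exists>q<n. \<exists>y\<in>\<Omega>. \<forall>s. apply_bcontfun x s = l s ^ q * apply_bcontfun y s"
    for n and S :: "(int \<Rightarrow>\<^sub>C complex) set"
  proof -
    define \<epsilon> where "\<epsilon> = 1 / real (K * n)"
    have \<epsilon>: "\<epsilon> > 0" using n K by (simp add: \<epsilon>_def)
    define h where "h s = (cell \<epsilon> (l s), g s)" for s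
    define J where "J = {- int (K * n)..int (K * n)}"
    have "cell \<epsilon> (l s) \<in> J \<times> J" for s
      unfolding J_def using n K
      by (intro cell_in_box[OF _ _ \<epsilon>, of _ 1]) (auto simp: l \<epsilon>_def)
    then have sub: "range h \<subseteq> (J \<times> J) \<times> range g"
      by (simp only: h_def image_subset_iff) simp
    have finJ: "finite ((J \<times> J) \<times> range g)" using g by (simp add: J_def)
    have "card (range h) \<le> card ((J \<times> J) \<times> range g)"
      by (rule card_mono[OF finJ sub])
    also have "\<dots> = (2 * (K * n) + 1)\<^sup>2 * card (range g)"
    proof -
      have "card J = 2 * (K * n) + 1" unfolding J_def by (simp only: card_atLeastAtMost_int)
      then show ?thesis by (simp add: card_cartesian_product power2_eq_square)
    qed
    finally have card: "card (range h) \<le> (2 * (K * n) + 1)\<^sup>2 * card (range g)" .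
    have "rc \<iota> S \<delta> \<le> card (range h)"
    proof (rule rc_le_card_range[where \<epsilon> = "\<delta> / 2"])
      show "clinear_on UNIV \<iota>" "\<And>x. norm (\<iota> x) = norm x"
        using \<iota> by (auto simp: CA_embedding_def)
      show "finite (range h)" using finite_subset[OF sub finJ] .
      show "\<delta> / 2 < \<delta>" using \<delta> by simp
      fix x s t assume x: "x \<in> S" and st: "h s = h t"
      obtain q y where q: "q < n" and y: "y \<in> \<Omega>"
        and xy: "\<And>s. apply_bcontfun x s = l s ^ q * apply_bcontfun y s"
        using S[OF x] by blast
      have "cell (\<delta> / 8) (apply_bcontfun y s) = cell (\<delta> / 8) (apply_bcontfun y t)"
        using st y by (auto simp: h_def g_def dest: fun_cong[where x = y])
      then have ydist: "cmod (apply_bcontfun y s - apply_bcontfun y t) \<le> \<delta> / 4"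
        using dist_le_of_cell_eq[of "\<delta> / 8"] \<delta> by fastforce
      have "cmod (l s ^ q - l t ^ q) \<le> q * cmod (l s - l t)"
        by (rule norm_power_diff) (simp_all add: l)
      also have "\<dots> \<le> n * (2 * \<epsilon>)"
        using st q \<epsilon> by (intro mult_mono dist_le_of_cell_eq) (auto simp: h_def)
      also have "\<dots> = 2 / K" using n by (simp add: \<epsilon>_def)
      finally have ldist: "cmod (l s ^ q - l t ^ q) \<le> 2 / K" .
      have "apply_bcontfun x s - apply_bcontfun x t
          = l s ^ q * (apply_bcontfun y s - apply_bcontfun y t) + (l s ^ q - l t ^ q) * apply_bcontfun y t"
        by (simp add: xy algebra_simps)
      also have "cmod \<dots> \<le> 1 * cmod (apply_bcontfun y s - apply_bcontfun y t)
          + cmod (l s ^ q - l t ^ q) * cmod (apply_bcontfun y t)"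
        using norm_triangle_ineq by (simp add: norm_mult norm_power l norm_triangle_le)
      also have "\<dots> \<le> 1 * (\<delta> / 4) + 2 / K * B"
        using ydist ldist B(2)[OF y] norm_bounded[of y t]
        by (intro add_mono mult_mono) (auto intro: order_trans)
      also have "\<dots> \<le> \<delta> / 2"
        using K0 K \<delta> by (simp add: field_simps)
      finally show "cmod (apply_bcontfun x s - apply_bcontfun x t) \<le> \<delta> / 2" .
    qed
    then show ?thesis using card by linarith
  qed
  then show ?thesis using that by blast
qed

text \<open>
  Dividing \<open>k\<close> by \<open>M\<close> with remainder reduces the iterates \<open>\<alpha> ^^ k\<close> to powers of a multiplication
  operator applied to the finite set of the first \<open>M\<close> images of \<open>\<Omega>\<close>.
\<close>

lemma hc3_bounded_orbits:
  fixes \<iota> :: "(int \<Rightarrow>\<^sub>C complex) \<Rightarrow> 'b::complex_banach"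
  assumes \<alpha>: "associated_permutation \<alpha> \<sigma>" and \<iota>: "CA_embedding \<iota>" and bdd: "bounded_orbits \<sigma>"
    and fin: "finite \<Omega>" and \<delta>: "\<delta> > 0"
  shows "hc3 \<iota> \<alpha> \<Omega> \<delta> \<le> 0"
proof -
  obtain M where M: "M > 0" "\<sigma> ^^ M = id"
    using bounded_orbits_common_period[OF _ bdd] \<alpha> unfolding associated_permutation_def by blast
  obtain l where l: "\<And>s. cmod (l s) = 1"
    "\<And>x s. apply_bcontfun ((\<alpha> ^^ M) x) s = l s * apply_bcontfun x s"
    using associated_permutation_funpow[OF \<alpha>, of M] M by (auto simp: associated_permutation_def)
  have pow: "apply_bcontfun ((\<alpha> ^^ (M * q)) y) s = l s ^ q * apply_bcontfun y s" for q y s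
    by (induction q) (simp_all add: funpow_add l)
  define \<Omega>' where "\<Omega>' = (\<Union>r<M. (\<alpha> ^^ r) ` \<Omega>)"
  have "finite \<Omega>'" using fin by (simp add: \<Omega>'_def)
  then obtain C K :: nat where CK: "\<And>n S. n > 0 \<Longrightarrow>
    (\<And>x. x \<in> S \<Longrightarrow> \<exists>q<n. \<exists>y\<in>\<Omega>'. \<forall>s. apply_bcontfun x s = l s ^ q * apply_bcontfun y s) \<Longrightarrow>
    rc \<iota> S \<delta> \<le> (2 * (K * n) + 1)\<^sup>2 * C"
    by (rule rc_multiplication_powers_le[where l = l, OF \<iota> _ \<delta> l(1)]) blast
  let ?R = "\<lambda>n. rc \<iota> (\<Union>k<n. (\<alpha> ^^ k) ` \<Omega>) \<delta>"
  have R: "?R n \<le> (2 * (K * n) + 1)\<^sup>2 * C" if "n > 0" for n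
  proof (rule CK[OF that])
    fix x assume "x \<in> (\<Union>k<n. (\<alpha> ^^ k) ` \<Omega>)"
    then obtain k z where k: "k < n" "z \<in> \<Omega>" "x = (\<alpha> ^^ k) z" by blast
    have "(\<alpha> ^^ k) z = (\<alpha> ^^ (M * (k div M))) ((\<alpha> ^^ (k mod M)) z)"
      by (metis comp_apply funpow_add mult_div_mod_eq)
    moreover have "(\<alpha> ^^ (k mod M)) z \<in> \<Omega>'"
      using k M by (auto simp: \<Omega>'_def)
    moreover have "k div M < n" using k(1) by (meson div_le_dividend order_le_less_trans)
    ultimately show "\<exists>q<n. \<exists>y\<in>\<Omega>'. \<forall>s. apply_bcontfun x s = l s ^ q * apply_bcontfun y s"
      using k pow by metis
  qed
  define D where "D = (2 * K + 1)\<^sup>2 * C"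
  have "1 / real n * ln (?R n) \<le> 2 * (ln n / n) + ln D / n" if n: "n > 0" for n
  proof -
    have "?R n > 0" using rc_pos[OF \<iota> _ \<delta>] fin by simp
    moreover have "?R n \<le> n\<^sup>2 * D"
    proof -
      have "2 * (K * n) + 1 \<le> n * (2 * K + 1)" using n by (simp add: algebra_simps)
      then have "(2 * (K * n) + 1)\<^sup>2 \<le> (n * (2 * K + 1))\<^sup>2" by (rule power_mono) simp
      then have "(2 * (K * n) + 1)\<^sup>2 * C \<le> (n * (2 * K + 1))\<^sup>2 * C" by (rule mult_right_mono) simp
      with R[OF n] have "?R n \<le> (n * (2 * K + 1))\<^sup>2 * C" by (rule order_trans)
      then show ?thesis unfolding D_def by (simp only: power_mult_distrib mult.assoc)
    qed
    ultimately have D: "D > 0" and le: "ln (?R n) \<le> ln (real (n\<^sup>2 * D))"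
      by (auto intro!: gr0I ln_mono simp del: of_nat_mult of_nat_power)
    note le
    also have "\<dots> = 2 * ln n + ln D"
      using n D by (simp add: ln_mult ln_realpow)
    finally show ?thesis using n by (simp add: field_simps)
  qed
  then have "eventually (\<lambda>n. ereal (1 / real n * ln (?R n)) \<le> ereal (2 * (ln n / n) + ln D / n)) sequentially"
    by (intro eventually_mono[OF eventually_gt_at_top[of 0]]) simp
  then have "hc3 \<iota> \<alpha> \<Omega> \<delta> \<le> limsup (\<lambda>n. ereal (2 * (ln n / n) + ln D / n))"
    unfolding hc3_def by (rule Limsup_mono)
  moreover have lim: "(\<lambda>n. ereal (2 * (ln (real n) / real n) + ln D / real n)) \<longlonglongrightarrow> ereal (2 * 0 + 0)"
    by (intro tendsto_ereal tendsto_add tendsto_mult tendsto_const lim_const_over_n lim_ln_over_n)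
  have "limsup (\<lambda>n. ereal (2 * (ln (real n) / real n) + ln D / real n)) = 0"
    using lim_imp_Limsup[OF sequentially_bot lim] by (simp add: zero_ereal_def)
  ultimately show ?thesis by simp
qed

lemma hc3_nonneg:
  assumes "CA_embedding \<iota>" "finite \<Omega>" "\<delta> > 0"
  shows "hc3 \<iota> \<alpha> \<Omega> \<delta> \<ge> 0"
proof -
  have "rc \<iota> (\<Union>k<n. (\<alpha> ^^ k) ` \<Omega>) \<delta> > 0" for n
    using rc_pos[OF assms(1) _ assms(3)] assms(2) by simp
  then have "ereal (1 / real n * ln (real (rc \<iota> (\<Union>k<n. (\<alpha> ^^ k) ` \<Omega>) \<delta>))) \<ge> 0" for n
    by (simp add: Suc_leI)
  then show ?thesis
    unfolding hc3_def by (intro le_Limsup always_eventually allI) simp_all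
qed

lemma hc_bounded_orbits:
  fixes \<iota> :: "(int \<Rightarrow>\<^sub>C complex) \<Rightarrow> 'b::complex_banach"
  assumes "associated_permutation \<alpha> \<sigma>" "CA_embedding \<iota>" "bounded_orbits \<sigma>"
  shows "hc \<iota> \<alpha> = 0"
proof -
  have "hc3 \<iota> \<alpha> \<Omega> \<delta> = 0" if "finite \<Omega>" "\<delta> > 0" for \<Omega> \<delta>
    using hc3_bounded_orbits[OF assms that] hc3_nonneg[OF assms(2) that] by (rule antisym)
  then have "hc2 \<iota> \<alpha> \<Omega> = 0" if "finite \<Omega>" for \<Omega>
    using that unfolding hc2_def by (subst SUP_eq_const[of _ _ 0]) auto
  then show ?thesis
    unfolding hc_def by (subst SUP_eq_const[of _ _ 0]) auto
qed

theorem proposition10p1: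
  fixes \<alpha> :: "(int \<Rightarrow>\<^sub>C complex) \<Rightarrow> (int \<Rightarrow>\<^sub>C complex)"
    and \<sigma> :: "int \<Rightarrow> int"
    and \<iota> :: "(int \<Rightarrow>\<^sub>C complex) \<Rightarrow> 'b::complex_banach"
  assumes "isometric_automorphism \<alpha>"
    and "associated_permutation \<alpha> \<sigma>"
    and "CA_embedding \<iota>"
  shows "(bounded_orbits \<sigma> \<longrightarrow> hc \<iota> \<alpha> = 0) \<and> (\<not> bounded_orbits \<sigma> \<longrightarrow> hc \<iota> \<alpha> = \<infinity>)"
  using hc_bounded_orbits[OF assms(2,3)] hc_unbounded_orbits[OF assms(2,3) _ assms(1)] by simp

end
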